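(* Let $d,m\ge 1$ be integers, let $A_1,\dots,A_m$ be positive semidefinite $d\times d$ matrices, let $\lambda_1,\dots,\lambda_m\ge 0$ be real numbers, and let $M$ be a real number such that \[ \sum_{i=1}^m \lambda_i A_i=\mathrm{Id}_d,\qquad \sum_{i=1}^m\lambda_i=1,\qquad \|A_i\|\le M\quad\text{for all } i\in\{1,\dots,m\}. \] Let $0<\epsilon\le 1$, and let $N$ be a positive integer with \[ N\ge 9\,\frac{M\ln(2d)}{\epsilon^2}. \] Then there exist indices $i_1,\dots,i_N\in\{1,\dots,m\}$ such that \[ \left\|\frac1N\sum_{r=1}^N A_{i_r}-\mathrm{Id}_d\right\|\le\epsilon. \]
   Context: Here $\|\cdot\|$ denotes the operator norm (largest singular value), $\mathrm{Id}_d$ is the $d\times d$ identity matrix, and $\ln$ is the natural logarithm. Positive semidefinite matrices are understood to be self-adjoint (real symmetric or complex Hermitian). The indices $i_r$ may repeat. *)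

theory Defs
  imports "HOL-Analysis.Analysis"
begin

text \<open>
  A \<open>d \<times> d\<close> matrix has type \<open>\<real>^'d^'d\<close> or \<open>\<complex>^'d^'d\<close> with \<open>d = CARD('d)\<close>. The norms on
  \<open>\<real>^'d\<close> and \<open>\<complex>^'d\<close> are the Euclidean (l2) norms, so the operator norm below is the spectral
  norm, i.e. the largest singular value. The supremum in \<^const>\<open>onorm\<close> runs over all vectors
  of the space the matrix acts on, hence over \<open>\<complex>^'d\<close> for a complex matrix.
\<close>

definition op_norm :: "'a::real_normed_field^'d^'d \<Rightarrow> real"
  where "op_norm A = onorm (\<lambda>x. A *v x)"

definition hermitian :: "complex^'d^'d \<Rightarrow> bool"
  where "hermitian A \<longleftrightarrow> (\<forall>i j. A $ i $ j = cnj (A $ j $ i))"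

text \<open>For Hermitian \<open>A\<close> the form \<open>x\<^sup>* A x\<close> is real-valued, so \<^const>\<open>Re\<close> loses nothing.\<close>

definition psd_complex :: "complex^'d^'d \<Rightarrow> bool"
  where "psd_complex A \<longleftrightarrow>
    hermitian A \<and> (\<forall>x. 0 \<le> Re (\<Sum>i\<in>UNIV. cnj (x $ i) * (A *v x) $ i))"

definition psd_real :: "real^'d^'d \<Rightarrow> bool"
  where "psd_real A \<longleftrightarrow> transpose A = A \<and> (\<forall>x. 0 \<le> x \<bullet> (A *v x))"

end

theory Submission
  imports Defs
begin

text \<open>
  With \<open>S\<close> the current sum, \<open>\<theta> = \<epsilon> / (2 M)\<close> and \<open>q\<close> a large power of two, the potentials
  \<open>tr ((1 + \<sigma> \<theta> S / q) ^ q)\<close>, \<open>\<sigma> = \<plusminus>1\<close>, stand in for \<open>tr (exp (\<sigma> \<theta> S))\<close> in the matrix Chernoff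
  argument. In the mean over the next index each grows by a factor of at most
  \<open>1 + \<theta> (\<sigma> + \<epsilon> / 2)\<close>, so the next index can be chosen such that the sum of the two potentials,
  each divided by its accumulated factor, does not increase. Writing
  \<open>W + \<sigma> a = R (1 + \<sigma> b) R\<close> with \<open>R\<^sup>2 = W\<close>, the Golden--Thompson inequality is replaced by
  \<open>tr ((X Y) ^ q) \<le> tr (X ^ q Y ^ q)\<close> for self-adjoint \<open>X\<close>, \<open>Y\<close>, which for powers of two follows
  from Cauchy--Schwarz alone.

  Operators act on a real Euclidean space, so \<open>\<complex>\<^sup>d\<close> counts with dimension \<open>2 d\<close>; since
  \<open>ln (4 d) \<le> 2 ln (2 d)\<close> and the argument only needs \<open>N > 4 M ln (2 D) / \<epsilon>\<^sup>2\<close> in dimension \<open>D\<close>,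
  the constant 9 leaves room for this.
\<close>

subsection \<open>Adjoint operators and a trace inequality for powers of two\<close>

text \<open>A relation instead of an adjoint function: it already forces both operators to be
  linear, so \<open>adj f f\<close> alone expresses that \<open>f\<close> is a self-adjoint linear
  operator.\<close>

definition adj :: "('a::euclidean_space \<Rightarrow> 'a) \<Rightarrow> ('a \<Rightarrow> 'a) \<Rightarrow> bool"
  where "adj f g \<longleftrightarrow> (\<forall>x y. f x \<bullet> y = x \<bullet> g y)"

definition tr :: "('a::euclidean_space \<Rightarrow> 'a) \<Rightarrow> real"
  where "tr f = (\<Sum>b\<in>Basis. f b \<bullet> b)"

lemma adjD: "adj f g \<Longrightarrow> f x \<bullet> y = x \<bullet> g y"
  by (simp add: adj_def)

lemma adj_sym: "adj f g \<Longrightarrow> adj g f"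
  unfolding adj_def by (metis inner_commute)

lemma adj_linear: "adj f g \<Longrightarrow> linear f"
  by (rule linearI; rule vector_eq_ldot[THEN iffD1])
    (auto simp: adj_def inner_commute[of _ "f _"] inner_add_left inner_add_right)

lemma adj_id: "adj id id"
  by (simp add: adj_def)

lemma adj_comp: "adj f f' \<Longrightarrow> adj g g' \<Longrightarrow> adj (f \<circ> g) (g' \<circ> f')"
  by (simp add: adj_def)

lemma adj_funpow: "adj f f' \<Longrightarrow> adj (f ^^ n) (f' ^^ n)"
proof (induction n)
  case (Suc n)
  then have "adj (f \<circ> f ^^ n) (f' ^^ n \<circ> f')" by (intro adj_comp) auto
  then show ?case by (simp only: funpow.simps funpow_Suc_right[symmetric])
qed (simp add: adj_def)

lemma adj_add_scaleR:
  "adj f f \<Longrightarrow> adj g g \<Longrightarrow> adj (\<lambda>x. f x + c *\<^sub>R g x) (\<lambda>x. f x + c *\<^sub>R g x)"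
  by (simp add: adj_def inner_add_left inner_add_right)

lemma adj_scaleR: "adj f f \<Longrightarrow> adj (\<lambda>x. c *\<^sub>R f x) (\<lambda>x. c *\<^sub>R f x)"
  by (simp add: adj_def)

lemma adj_sum:
  "(\<And>i. i \<in> I \<Longrightarrow> adj (f i) (f i)) \<Longrightarrow> adj (\<lambda>x. \<Sum>i\<in>I. f i x) (\<lambda>x. \<Sum>i\<in>I. f i x)"
  by (simp add: adj_def inner_sum_left inner_sum_right)

lemma linear_funpow:
  fixes f :: "'a::real_vector \<Rightarrow> 'a"
  shows "linear f \<Longrightarrow> linear (f ^^ n)"
proof (induction n)
  case 0
  show ?case by (simp add: linear_iff)
next
  case (Suc n)
  then show ?case by (simp only: funpow_Suc_right linear_compose)
qed

lemma tr_cyclic: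
  fixes f g :: "'a::euclidean_space \<Rightarrow> 'a"
  assumes "linear f" "linear g"
  shows "tr (f \<circ> g) = tr (g \<circ> f)"
proof -
  have *: "tr (f \<circ> g) = (\<Sum>b\<in>Basis. \<Sum>c\<in>Basis. (g b \<bullet> c) * (f c \<bullet> b))"
    if "linear f" for f g :: "'a \<Rightarrow> 'a"
  proof -
    have "f (g b) = (\<Sum>c\<in>Basis. (g b \<bullet> c) *\<^sub>R f c)" for b
      by (subst euclidean_representation[of "g b", symmetric])
        (simp add: linear_sum[OF that] linear_cmul[OF that] del: euclidean_representation)
    then show ?thesis by (simp add: tr_def inner_sum_left)
  qed
  show ?thesis
    unfolding *[OF assms(1)] *[OF assms(2)]
    by (subst sum.swap) (simp add: mult.commute)
qed

lemma tr_cyclic_funpow: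
  fixes f g :: "'a::euclidean_space \<Rightarrow> 'a"
  assumes "linear f" "linear g"
  shows "tr ((f \<circ> g) ^^ n) = tr ((g \<circ> f) ^^ n)"
proof (cases n)
  case (Suc m)
  have *: "(f \<circ> g) ^^ m \<circ> f = f \<circ> (g \<circ> f) ^^ m"
    by (induction m) (auto simp: fun_eq_iff)
  have "(f \<circ> g) ^^ n = ((f \<circ> g) ^^ m \<circ> f) \<circ> g"
    by (simp only: Suc funpow_Suc_right comp_assoc)
  then have "tr ((f \<circ> g) ^^ n) = tr (f \<circ> ((g \<circ> f) ^^ m \<circ> g))"
    by (simp only: * comp_assoc)
  also have "\<dots> = tr (((g \<circ> f) ^^ m \<circ> g) \<circ> f)"
    using assms by (intro tr_cyclic linear_compose linear_funpow)
  also have "\<dots> = tr ((g \<circ> f) ^^ n)"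
    by (simp only: Suc funpow_Suc_right comp_assoc)
  finally show ?thesis .
qed simp

text \<open>Cauchy--Schwarz for the Hilbert--Schmidt inner product in its arithmetic-mean form:
  expand \<open>0 \<le> (f' b - g b) \<bullet> (f' b - g b)\<close> and sum over the basis.\<close>

lemma tr_comp_le:
  assumes "adj f f'" "adj g g'"
  shows "tr (f \<circ> g) \<le> (tr (f \<circ> f') + tr (g' \<circ> g)) / 2"
proof -
  have "f (g b) \<bullet> b \<le> (f (f' b) \<bullet> b + g' (g b) \<bullet> b) / 2" for b
    using inner_ge_zero[of "f' b - g b"] adjD[OF assms(1)] adjD[OF adj_sym[OF assms(2)]]
    by (simp add: inner_diff_left inner_diff_right inner_commute)
  then show ?thesis
    by (simp add: tr_def sum.distrib[symmetric] sum_divide_distrib sum_mono)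
qed

text \<open>The two parts feed each other in the induction: the first part for \<open>f \<circ> g\<close> squares the factors
  of the second, and the second bounds the trace that arises from the first for \<open>f \<circ> f\<close>.\<close>

lemma tr_funpow_two_power:
  shows "\<And>f f' :: 'a::euclidean_space \<Rightarrow> 'a. adj f f' \<Longrightarrow> tr (f ^^ (2 * 2 ^ k)) \<le> tr ((f' \<circ> f) ^^ (2 ^ k))"
    and "\<And>f g :: 'a \<Rightarrow> 'a. adj f f \<Longrightarrow> adj g g \<Longrightarrow>
      tr ((f \<circ> g) ^^ (2 ^ k)) \<le> tr (f ^^ (2 ^ k) \<circ> g ^^ (2 ^ k))"
proof (induction k)
  case 0
  fix f f' :: "'a \<Rightarrow> 'a" assume *: "adj f f'"
  then have "tr (f \<circ> f) \<le> (tr (f \<circ> f') + tr (f' \<circ> f)) / 2"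
    by (rule tr_comp_le) (rule *)
  also have "tr (f \<circ> f') = tr (f' \<circ> f)"
    using * by (intro tr_cyclic) (auto intro: adj_linear adj_sym)
  finally show "tr (f ^^ (2 * 2 ^ 0)) \<le> tr ((f' \<circ> f) ^^ (2 ^ 0))"
    by (simp add: numeral_2_eq_2 comp_def)
next
  case 0
  fix f g :: "'a \<Rightarrow> 'a"
  show "tr ((f \<circ> g) ^^ (2 ^ 0)) \<le> tr (f ^^ (2 ^ 0) \<circ> g ^^ (2 ^ 0))" by simp
next
  case (Suc k)
  let ?n = "2 ^ k :: nat"
  have square: "f ^^ (2 * 2 ^ Suc k) = (f \<circ> f) ^^ (2 * ?n)" for f :: "'a \<Rightarrow> 'a"
    using funpow_mult[where f=f and m=2 and n="2 * ?n"]
    by (simp add: numeral_2_eq_2 mult.commute comp_def)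
  fix f f' :: "'a \<Rightarrow> 'a" assume f: "adj f f'"
  note f' = adj_sym[OF f]
  have lin: "linear f" "linear f'" using f f' by (auto intro: adj_linear)
  \<comment> \<open>Both products are self-adjoint, and by cyclicity their equal powers have equal
    traces. Hence the mean that \<open>tr_comp_le\<close> produces below collapses to a single trace
    of a power of \<open>?P\<close>.\<close>
  let ?P = "f' \<circ> f" and ?Q = "f \<circ> f'"
  have PQ: "adj ?P ?P" "adj ?Q ?Q" using f f' by (auto intro: adj_comp)
  have "tr (f ^^ (2 * 2 ^ Suc k)) \<le> tr (((f' \<circ> f') \<circ> (f \<circ> f)) ^^ ?n)"
    unfolding square by (rule Suc.IH(1)) (intro adj_comp f)
  also have "(f' \<circ> f') \<circ> (f \<circ> f) = f' \<circ> (f' \<circ> f \<circ> f)" by (simp add: comp_assoc)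
  also have "tr (\<dots> ^^ ?n) = tr (((f' \<circ> f \<circ> f) \<circ> f') ^^ ?n)"
    using lin by (intro tr_cyclic_funpow linear_compose)
  also have "(f' \<circ> f \<circ> f) \<circ> f' = ?P \<circ> ?Q" by (simp add: comp_assoc)
  also have "tr ((?P \<circ> ?Q) ^^ ?n) \<le> tr (?P ^^ ?n \<circ> ?Q ^^ ?n)"
    by (rule Suc.IH(2)) (rule PQ)+
  also have "\<dots> \<le> (tr (?P ^^ ?n \<circ> ?P ^^ ?n) + tr (?Q ^^ ?n \<circ> ?Q ^^ ?n)) / 2"
    by (intro tr_comp_le adj_funpow PQ)
  also have "\<dots> = tr (?P ^^ (2 ^ Suc k))"
  proof -
    have "g ^^ ?n \<circ> g ^^ ?n = g ^^ (2 ^ Suc k)" for g :: "'a \<Rightarrow> 'a"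
      by (simp only: funpow_add[symmetric] power_Suc mult_2)
    then show ?thesis
      using tr_cyclic_funpow[OF lin, of "2 ^ Suc k"] by (simp only:) simp
  qed
  finally show "tr (f ^^ (2 * 2 ^ Suc k)) \<le> tr ((f' \<circ> f) ^^ (2 ^ Suc k))" .
next
  case (Suc k)
  let ?n = "2 ^ k :: nat"
  fix f g :: "'a \<Rightarrow> 'a" assume f: "adj f f" and g: "adj g g"
  have lin: "linear f" "linear g" using f g by (auto intro: adj_linear)
  have square: "(f \<circ> f) ^^ ?n = f ^^ (2 ^ Suc k)" for f :: "'a \<Rightarrow> 'a"
    using funpow_mult[where f=f and m=2 and n="?n"] by (simp add: numeral_2_eq_2 mult.commute comp_def)
  have "tr ((f \<circ> g) ^^ (2 ^ Suc k)) \<le> tr (((g \<circ> f) \<circ> (f \<circ> g)) ^^ ?n)"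
    unfolding power_Suc by (rule Suc.IH(1)[OF adj_comp[OF f g]])
  also have "(g \<circ> f) \<circ> (f \<circ> g) = g \<circ> (f \<circ> f \<circ> g)" by (simp add: comp_assoc)
  also have "tr (\<dots> ^^ ?n) = tr (((f \<circ> f \<circ> g) \<circ> g) ^^ ?n)"
    using lin by (intro tr_cyclic_funpow linear_compose)
  also have "(f \<circ> f \<circ> g) \<circ> g = (f \<circ> f) \<circ> (g \<circ> g)" by (simp add: comp_assoc)
  also have "tr (\<dots> ^^ ?n) \<le> tr ((f \<circ> f) ^^ ?n \<circ> (g \<circ> g) ^^ ?n)"
    by (rule Suc.IH(2)) (intro adj_comp f g)+
  finally show "tr ((f \<circ> g) ^^ (2 ^ Suc k)) \<le> tr (f ^^ (2 ^ Suc k) \<circ> g ^^ (2 ^ Suc k))"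
    unfolding square .
qed

subsection \<open>Spectral theorem\<close>

text \<open>A maximiser \<open>v\<close> of the quadratic form on the unit sphere of
  \<open>V\<close> is an eigenvector: a nonzero residual \<open>W v - \<mu> v\<close> would be a
  direction inside \<open>V\<close> along which the maximum is exceeded.\<close>

lemma selfadj_has_eigenvector:
  fixes W :: "'a::euclidean_space \<Rightarrow> 'a"
  assumes W: "adj W W" and V: "subspace V" "W ` V \<subseteq> V" and ne: "V \<noteq> {0}"
  obtains v \<mu> where "v \<in> V" "norm v = 1" "W v = \<mu> *\<^sub>R v"
proof -
  have lin: "linear W" using W by (rule adj_linear)
  have "compact (V \<inter> sphere 0 1)"
    by (intro closed_Int_compact closed_subspace V compact_sphere)
  moreover obtain u where u: "u \<in> V" "u \<noteq> 0" using ne subspace_0[OF V(1)] by blast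
  then have "u /\<^sub>R norm u \<in> V \<inter> sphere 0 1"
    using subspace_scale[OF V(1)] by simp
  then have "V \<inter> sphere 0 1 \<noteq> {}" by blast
  moreover have "continuous_on (V \<inter> sphere 0 1) (\<lambda>x. W x \<bullet> x)"
    using lin by (intro continuous_intros linear_continuous_on)
      (auto simp: linear_conv_bounded_linear)
  ultimately have "\<exists>v\<in>V \<inter> sphere 0 1. \<forall>x\<in>V \<inter> sphere 0 1. W x \<bullet> x \<le> W v \<bullet> v"
    by (rule continuous_attains_sup)
  then obtain v where v: "v \<in> V" "norm v = 1"
    and max: "\<And>x. x \<in> V \<Longrightarrow> norm x = 1 \<Longrightarrow> W x \<bullet> x \<le> W v \<bullet> v"
    by auto
  define \<mu> where "\<mu> = W v \<bullet> v"
  \<comment> \<open>The defect from the maximum, extended homogeneously from the sphere, so that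
    perturbations of \<open>v\<close> need no renormalisation.\<close>
  define Q where "Q x = \<mu> * (x \<bullet> x) - W x \<bullet> x" for x
  have Q: "0 \<le> Q x" if "x \<in> V" for x
  proof (cases "x = 0")
    case False
    have "W (x /\<^sub>R norm x) \<bullet> (x /\<^sub>R norm x) \<le> \<mu>"
      unfolding \<mu>_def using that False subspace_scale[OF V(1)] by (intro max) auto
    then have "W x \<bullet> x / (norm x)\<^sup>2 \<le> \<mu>"
      by (simp add: linear_cmul[OF lin] power2_eq_square field_simps)
    then show ?thesis using False
      by (simp add: Q_def field_simps power2_norm_eq_inner)
  qed (simp add: Q_def)
  define y where "y = W v - \<mu> *\<^sub>R v"
  have y: "y \<in> V" unfolding y_def
    using V v by (intro subspace_diff subspace_scale) auto
  \<comment> \<open>Small enough that \<open>t * Q y \<le> y \<bullet> y\<close>, which makes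
    \<open>Q (v + t y)\<close> negative unless \<open>y = 0\<close>. The summand 1 keeps the
    denominator positive when \<open>Q y = 0\<close>.\<close>
  define t where "t = (y \<bullet> y) / (Q y + 1)"
  have "Q (v + t *\<^sub>R y) = t * (t * Q y - 2 * (y \<bullet> y))"
  proof -
    have vv: "v \<bullet> v = 1" using v(2) by (simp add: norm_eq_sqrt_inner)
    have yv: "y \<bullet> v = 0" "v \<bullet> y = 0"
      by (simp_all add: y_def inner_diff_left inner_diff_right vv \<mu>_def inner_commute)
    have Wv: "W v = y + \<mu> *\<^sub>R v" by (simp add: y_def)
    have "W y \<bullet> v = y \<bullet> y" by (simp add: adjD[OF W] Wv inner_add_right yv)
    then show ?thesis
      by (simp add: Q_def Wv linear_add[OF lin] linear_cmul[OF lin] inner_add_left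
          inner_add_right vv yv algebra_simps)
  qed
  moreover have "0 \<le> Q (v + t *\<^sub>R y)"
    using V v y by (intro Q subspace_add subspace_scale)
  ultimately have "0 \<le> t * (t * Q y - 2 * (y \<bullet> y))" by simp
  moreover have "t * Q y \<le> y \<bullet> y"
    using Q[OF y] inner_ge_zero[of y] by (simp add: t_def field_simps)
  moreover have "0 < t" if "y \<noteq> 0"
    using Q[OF y] that by (simp add: t_def)
  moreover have "0 < y \<bullet> y" if "y \<noteq> 0"
    using that by simp
  ultimately have "y = 0"
    by (smt (verit) zero_le_mult_iff)
  then show thesis using that[of v \<mu>] v by (simp add: y_def)
qed

definition orthonormal_basis :: "'a::euclidean_space set \<Rightarrow> bool"
  where "orthonormal_basis E \<longleftrightarrow>
    pairwise orthogonal E \<and> (\<forall>e\<in>E. norm e = 1) \<and> span E = UNIV"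

text \<open>Induction on the dimension: split off an eigenvector \<open>v\<close>; by
  self-adjointness its orthogonal complement within \<open>V\<close> is again invariant. The
  invariant subspace \<open>V\<close> in the statement is what the induction passes to.\<close>

lemma selfadj_diagonalizable_on_subspace:
  fixes W :: "'a::euclidean_space \<Rightarrow> 'a"
  assumes W: "adj W W"
  shows "subspace V \<Longrightarrow> W ` V \<subseteq> V \<Longrightarrow> \<exists>E. pairwise orthogonal E \<and> span E = V \<and>
    (\<forall>e\<in>E. norm e = 1 \<and> (\<exists>\<mu>. W e = \<mu> *\<^sub>R e))"
proof (induction "dim V" arbitrary: V rule: less_induct)
  case less
  have lin: "linear W" using W by (rule adj_linear)
  show ?case
  proof (cases "V = {0}")
    case True
    then show ?thesis by (intro exI[of _ "{}"]) (auto simp: pairwise_def)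
  next
    case False
    then obtain v \<mu> where v: "v \<in> V" "norm v = 1" "W v = \<mu> *\<^sub>R v"
      using selfadj_has_eigenvector[OF W less.prems] by blast
    let ?V = "V \<inter> {x. orthogonal v x}"
    have sub: "subspace ?V"
      using less.prems by (intro subspace_inter subspace_orthogonal_to_vector)
    have "v \<notin> ?V" using v(2) by (auto simp: orthogonal_def norm_eq_sqrt_inner)
    then have "dim ?V < dim V"
      using v(1) less.prems(1) sub by (intro dim_psubset) (auto simp: span_eq_iff[THEN iffD2])
    moreover have "W ` ?V \<subseteq> ?V"
      using less.prems adjD[OF W, of v, symmetric] v(3) by (auto simp: orthogonal_def)
    ultimately obtain E where E: "pairwise orthogonal E" "span E = ?V"
      "\<forall>e\<in>E. norm e = 1 \<and> (\<exists>\<mu>. W e = \<mu> *\<^sub>R e)"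
      using less.hyps sub by metis
    have EV: "E \<subseteq> ?V" using E(2) span_superset by blast
    have "span (insert v E) = V"
    proof
      show "span (insert v E) \<subseteq> V"
        using EV v(1) less.prems(1) by (intro span_minimal) auto
      show "V \<subseteq> span (insert v E)"
      proof
        fix x assume "x \<in> V"
        then have "x - (v \<bullet> x) *\<^sub>R v \<in> ?V"
          using v less.prems(1)
          by (auto simp: orthogonal_def inner_diff_right norm_eq_sqrt_inner
              intro: subspace_diff subspace_scale)
        then show "x \<in> span (insert v E)"
          unfolding E(2)[symmetric] by (auto simp: span_insert)
      qed
    qed
    moreover have "pairwise orthogonal (insert v E)"
      using E(1) EV by (intro pairwise_orthogonal_insert) auto
    ultimately show ?thesis using E(3) v by (intro exI[of _ "insert v E"]) auto
  qed
qed

text \<open>For an orthonormal basis \<open>E\<close> this is the operator with eigenvalue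
  \<open>g e\<close> at \<open>e\<close>. Indexing eigenvalues by eigenvectors turns products,
  powers, square roots and inverses into pointwise operations on \<open>g\<close>.\<close>

definition spec :: "'a::euclidean_space set \<Rightarrow> ('a \<Rightarrow> real) \<Rightarrow> 'a \<Rightarrow> 'a"
  where "spec E g x = (\<Sum>e\<in>E. (g e * (x \<bullet> e)) *\<^sub>R e)"

lemma adj_spec: "adj (spec E g) (spec E g)"
  by (simp add: adj_def spec_def inner_sum_left inner_sum_right inner_commute mult_ac)

lemma linear_spec: "linear (spec E g)"
  using adj_spec by (rule adj_linear)

lemma inner_spec: "spec E g x \<bullet> x = (\<Sum>e\<in>E. g e * (x \<bullet> e)\<^sup>2)"
  by (simp add: spec_def inner_sum_left inner_sum_right inner_commute[of _ x] power2_eq_square mult_ac)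

lemma tr_comp_spec:
  fixes f :: "'a::euclidean_space \<Rightarrow> 'a"
  assumes "linear f"
  shows "tr (f \<circ> spec E g) = (\<Sum>e\<in>E. g e * (f e \<bullet> e))"
proof -
  have *: "f (spec E g b) \<bullet> b = (\<Sum>e\<in>E. g e * ((e \<bullet> b) * (f e \<bullet> b)))" for b
    by (simp add: spec_def linear_sum[OF assms] linear_cmul[OF assms]
        inner_sum_left inner_commute[of b] mult_ac)
  have "tr (f \<circ> spec E g) = (\<Sum>b\<in>Basis. \<Sum>e\<in>E. g e * ((e \<bullet> b) * (f e \<bullet> b)))"
    by (simp add: tr_def *)
  also have "\<dots> = (\<Sum>e\<in>E. g e * (\<Sum>b\<in>Basis. (e \<bullet> b) * (f e \<bullet> b)))"
    unfolding sum_distrib_left by (rule sum.swap)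
  finally show ?thesis
    unfolding euclidean_inner[of "_ :: 'a", symmetric] by (simp add: inner_commute)
qed

context
  fixes E :: "'a::euclidean_space set"
  assumes E: "orthonormal_basis E"
begin

lemma orthonormal_basis_inner: "e \<in> E \<Longrightarrow> f \<in> E \<Longrightarrow> e \<bullet> f = (if e = f then 1 else 0)"
  using E by (auto simp: orthonormal_basis_def pairwise_def orthogonal_def norm_eq_sqrt_inner)

lemma finite_orthonormal_basis: "finite E"
  using E pairwise_orthogonal_imp_finite by (auto simp: orthonormal_basis_def)

lemma linear_eq_on_orthonormal_basis:
  "linear f \<Longrightarrow> linear g \<Longrightarrow> (\<And>e. e \<in> E \<Longrightarrow> f e = g e) \<Longrightarrow> f = g"
  using E linear_eq_on_span[of f g E] by (auto simp: orthonormal_basis_def fun_eq_iff)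

lemma spec_on_basis: "e \<in> E \<Longrightarrow> spec E g e = g e *\<^sub>R e"
  using finite_orthonormal_basis
  by (simp add: spec_def orthonormal_basis_inner if_distrib[of "\<lambda>x. _ * x"]
      if_distrib[of "\<lambda>x. x *\<^sub>R _"] cong: if_cong)

lemma spec_eqI: "linear f \<Longrightarrow> (\<And>e. e \<in> E \<Longrightarrow> f e = g e *\<^sub>R e) \<Longrightarrow> f = spec E g"
  by (rule linear_eq_on_orthonormal_basis) (simp_all add: linear_spec spec_on_basis)

lemma spec_comp: "spec E g \<circ> spec E h = spec E (\<lambda>e. g e * h e)"
  by (rule spec_eqI)
    (simp_all add: linear_compose linear_spec spec_on_basis linear_cmul[OF linear_spec])

lemma spec_one: "spec E (\<lambda>e. 1) = id"
  by (rule spec_eqI[symmetric]) (simp_all add: linear_id)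

lemma spec_funpow: "spec E g ^^ n = spec E (\<lambda>e. g e ^ n)"
  by (induction n) (simp_all add: spec_one spec_comp)

lemma tr_eq_sum_orthonormal_basis: "linear f \<Longrightarrow> tr f = (\<Sum>e\<in>E. f e \<bullet> e)"
  using tr_comp_spec[of f E "\<lambda>e. 1"] by (simp add: spec_one)

lemma norm_eq_sum_orthonormal_basis: "x \<bullet> x = (\<Sum>e\<in>E. (x \<bullet> e)\<^sup>2)"
  using inner_spec[of E "\<lambda>e. 1" x] by (simp add: spec_one)

end

text \<open>The eigenvalues are delivered as values of the quadratic form, so every bound on the
  form is at once a bound on them.\<close>

lemma selfadj_obtain_spec:
  assumes W: "adj W W"
  obtains E \<mu> where "orthonormal_basis E" "W = spec E \<mu>" "\<And>e. e \<in> E \<Longrightarrow> \<mu> e = W e \<bullet> e"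
proof -
  obtain E where "pairwise orthogonal E" "span E = UNIV"
    and eig: "\<forall>e\<in>E. norm e = 1 \<and> (\<exists>\<mu>. W e = \<mu> *\<^sub>R e)"
    using selfadj_diagonalizable_on_subspace[OF W, of UNIV] by auto
  then have E: "orthonormal_basis E" by (simp add: orthonormal_basis_def)
  have "W e = (W e \<bullet> e) *\<^sub>R e" if "e \<in> E" for e
    using eig that orthonormal_basis_inner[OF E] by force
  then have "W = spec E (\<lambda>e. W e \<bullet> e)"
    by (intro spec_eqI[OF E] adj_linear[OF W])
  with E show thesis by (rule that) simp
qed

subsection \<open>One step of the potential\<close>

text \<open>Conjugation by a square root makes the additive perturbation a product; the trace
  inequality then separates the powers of its factors, and the scalar bound with
  \<open>\<kappa>\<close> applies to the eigenvalues of one of them. The resulting bound is affine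
  in \<open>a\<close>, hence compatible with averaging.\<close>

lemma tr_funpow_perturbation_le:
  fixes a :: "'a::euclidean_space \<Rightarrow> 'a"
  assumes E: "orthonormal_basis E" and a: "adj a a" and w: "0 < w"
    and \<mu>: "\<And>e. e \<in> E \<Longrightarrow> w \<le> \<mu> e"
    and a_nonneg: "\<And>x. 0 \<le> a x \<bullet> x" and a_le: "\<And>x. a x \<bullet> x \<le> w * \<tau> * (x \<bullet> x)"
    and q: "q = 2 ^ k"
    and \<kappa>: "\<And>t. 0 \<le> t \<Longrightarrow> t \<le> \<tau> \<Longrightarrow> (1 + \<sigma> * t) ^ q \<le> 1 + \<kappa> * t"
  shows "tr ((\<lambda>x. spec E \<mu> x + \<sigma> *\<^sub>R a x) ^^ q) \<le>
    (\<Sum>e\<in>E. \<mu> e ^ q + \<kappa> * (\<mu> e ^ q / \<mu> e * (a e \<bullet> e)))"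
proof -
  have pos: "0 < \<mu> e" if "e \<in> E" for e using \<mu>[OF that] w by simp
  \<comment> \<open>\<open>R\<close> is the square root of \<open>spec E \<mu>\<close> and
    \<open>T\<close> its inverse. With \<open>B = T a T\<close> the perturbed operator becomes
    \<open>R (1 + \<sigma> B) R\<close>.\<close>
  define R T where "R = spec E (\<lambda>e. sqrt (\<mu> e))" and "T = spec E (\<lambda>e. 1 / sqrt (\<mu> e))"
  have spec_cong: "spec E g = spec E h" if "\<And>e. e \<in> E \<Longrightarrow> g e = h e" for g h
    using that by (simp add: spec_def fun_eq_iff)
  have RR: "R \<circ> R = spec E \<mu>"
    unfolding R_def spec_comp[OF E] by (rule spec_cong) (use pos in \<open>simp add: less_imp_le\<close>)
  have RT: "R \<circ> T = id" and TR: "T \<circ> R = id"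
    unfolding R_def T_def spec_comp[OF E] spec_one[OF E, symmetric]
    by (rule spec_cong; use pos in \<open>force\<close>)+
  have adjR: "adj R R" and adjT: "adj T T" by (simp_all add: R_def T_def adj_spec)
  have linR: "linear R" and linT: "linear T" and lina: "linear a"
    using adjR adjT a by (auto intro: adj_linear)
  define B where "B = T \<circ> (a \<circ> T)"
  have adjB: "adj B B"
    using adj_comp[OF adjT adj_comp[OF a adjT]] by (simp add: B_def comp_assoc)
  obtain F \<nu> where F: "orthonormal_basis F" and B: "B = spec F \<nu>"
    and \<nu>: "\<And>f. f \<in> F \<Longrightarrow> \<nu> f = B f \<bullet> f"
    using selfadj_obtain_spec[OF adjB] by blast
  have B_form: "B x \<bullet> x = a (T x) \<bullet> T x" for x
    by (simp add: B_def adjD[OF adjT])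
  \<comment> \<open>The square of \<open>T\<close> has eigenvalues \<open>1 / \<mu> e\<close>, at
    most \<open>1 / w\<close>. This cancels the factor \<open>w\<close> in \<open>a_le\<close> and
    leaves \<open>\<tau>\<close> as the bound for the eigenvalues of \<open>B\<close>.\<close>
  have T_form: "w * (T x \<bullet> T x) \<le> x \<bullet> x" for x
  proof -
    have "T x \<bullet> T x = (T \<circ> T) x \<bullet> x" by (simp add: adjD[OF adjT])
    also have "\<dots> = (\<Sum>e\<in>E. 1 / \<mu> e * (x \<bullet> e)\<^sup>2)"
      unfolding T_def spec_comp[OF E] inner_spec
      by (rule sum.cong) (use pos in \<open>auto simp: less_imp_le\<close>)
    also have "w * \<dots> = (\<Sum>e\<in>E. w / \<mu> e * (x \<bullet> e)\<^sup>2)"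
      by (simp add: sum_distrib_left)
    also have "\<dots> \<le> (\<Sum>e\<in>E. 1 * (x \<bullet> e)\<^sup>2)"
      using pos \<mu> by (intro sum_mono mult_right_mono) auto
    also have "\<dots> = x \<bullet> x" by (simp add: norm_eq_sum_orthonormal_basis[OF E])
    finally show ?thesis .
  qed
  have \<nu>_bounds: "0 \<le> \<nu> f" "\<nu> f \<le> \<tau>" if "f \<in> F" for f
  proof -
    show "0 \<le> \<nu> f" by (simp add: \<nu>[OF that] B_form a_nonneg)
    have ff: "f \<bullet> f = 1" using orthonormal_basis_inner[OF F that that] by simp
    have "0 \<le> w * \<tau>" using order_trans[OF a_nonneg a_le, of f] by (simp add: ff)
    then have "0 \<le> \<tau>" using w by (simp add: zero_le_mult_iff)
    have "\<nu> f \<le> \<tau> * (w * (T f \<bullet> T f))"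
      using a_le[of "T f"] by (simp add: \<nu>[OF that] B_form mult_ac)
    also have "\<dots> \<le> \<tau> * 1"
      using T_form[of f] \<open>0 \<le> \<tau>\<close> by (intro mult_left_mono) (simp_all add: ff)
    finally show "\<nu> f \<le> \<tau>" by simp
  qed
  define C where "C = spec F (\<lambda>f. 1 + \<sigma> * \<nu> f)"
  have C_eq: "C = (\<lambda>x. x + \<sigma> *\<^sub>R B x)"
  proof -
    have "(\<lambda>x. x + \<sigma> *\<^sub>R B x) = spec F (\<lambda>f. 1 + \<sigma> * \<nu> f)"
      using adj_linear[OF adjB]
      by (intro spec_eqI[OF F] linear_compose_add linear_compose_scale_right linear_ident)
        (simp_all add: B spec_on_basis[OF F] algebra_simps)
    then show ?thesis by (simp add: C_def)
  qed
  have adjC: "adj C C" by (simp add: C_def adj_spec)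
  then have linC: "linear C" by (rule adj_linear)
  have "(\<lambda>x. spec E \<mu> x + \<sigma> *\<^sub>R a x) = R \<circ> (C \<circ> R)"
  proof
    fix x
    have "R (C (R x)) = (R \<circ> R) x + \<sigma> *\<^sub>R (R \<circ> T) (a ((T \<circ> R) x))"
      by (simp add: C_eq B_def linear_add[OF linR] linear_cmul[OF linR])
    then show "spec E \<mu> x + \<sigma> *\<^sub>R a x = (R \<circ> (C \<circ> R)) x" by (simp add: RR RT TR)
  qed
  then have "tr ((\<lambda>x. spec E \<mu> x + \<sigma> *\<^sub>R a x) ^^ q) = tr ((C \<circ> R \<circ> R) ^^ q)"
    using linR linC tr_cyclic_funpow[of R "C \<circ> R" q] by (simp only: linear_compose)
  also have "C \<circ> R \<circ> R = C \<circ> spec E \<mu>" by (simp add: comp_assoc RR)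
  also have "tr (\<dots> ^^ q) \<le> tr (C ^^ q \<circ> spec E \<mu> ^^ q)"
    unfolding q by (rule tr_funpow_two_power(2)) (auto simp: adjC adj_spec)
  also have "\<dots> = tr (spec E (\<lambda>e. \<mu> e ^ q) \<circ> spec F (\<lambda>f. (1 + \<sigma> * \<nu> f) ^ q))"
    unfolding C_def spec_funpow[OF E] spec_funpow[OF F]
    by (intro tr_cyclic linear_spec)
  also have "\<dots> = (\<Sum>f\<in>F. (1 + \<sigma> * \<nu> f) ^ q * (spec E (\<lambda>e. \<mu> e ^ q) f \<bullet> f))"
    by (rule tr_comp_spec) (rule linear_spec)
  \<comment> \<open>Termwise use of the scalar bound is legitimate because the weights are values of
    a quadratic form with eigenvalues \<open>\<mu> e ^ q > 0\<close>.\<close>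
  also have "\<dots> \<le> (\<Sum>f\<in>F. (1 + \<kappa> * \<nu> f) * (spec E (\<lambda>e. \<mu> e ^ q) f \<bullet> f))"
    by (intro sum_mono mult_right_mono \<kappa> \<nu>_bounds)
      (simp_all add: inner_spec sum_nonneg pos less_imp_le)
  also have "\<dots> = tr (spec E (\<lambda>e. \<mu> e ^ q)) + \<kappa> * tr (spec E (\<lambda>e. \<mu> e ^ q) \<circ> B)"
    unfolding B tr_comp_spec[OF linear_spec] tr_eq_sum_orthonormal_basis[OF F linear_spec]
    by (simp add: sum.distrib sum_distrib_left algebra_simps)
  also have "tr (spec E (\<lambda>e. \<mu> e ^ q)) = (\<Sum>e\<in>E. \<mu> e ^ q)"
    unfolding tr_eq_sum_orthonormal_basis[OF E linear_spec]
    by (simp add: spec_on_basis[OF E] orthonormal_basis_inner[OF E])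
  \<comment> \<open>Cyclicity brings the two factors \<open>T\<close> of \<open>B\<close> around the
    diagonal power; all three commute, and together they lower the exponent by one, written as
    \<open>\<mu> e ^ q / \<mu> e\<close>.\<close>
  also have "tr (spec E (\<lambda>e. \<mu> e ^ q) \<circ> B) = tr ((spec E (\<lambda>e. \<mu> e ^ q) \<circ> T \<circ> a) \<circ> T)"
    by (simp add: B_def comp_assoc)
  also have "\<dots> = tr ((T \<circ> spec E (\<lambda>e. \<mu> e ^ q) \<circ> T) \<circ> a)"
    using linT lina by (subst tr_cyclic) (auto intro!: linear_compose linear_spec simp: comp_assoc)
  also have "\<dots> = tr (a \<circ> (T \<circ> spec E (\<lambda>e. \<mu> e ^ q) \<circ> T))"
    using linT lina by (intro tr_cyclic linear_compose linear_spec)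
  also have "T \<circ> spec E (\<lambda>e. \<mu> e ^ q) \<circ> T = spec E (\<lambda>e. \<mu> e ^ q / \<mu> e)"
    unfolding T_def spec_comp[OF E]
    by (rule spec_cong) (use pos in \<open>simp add: less_imp_le\<close>)
  also have "tr (a \<circ> \<dots>) = (\<Sum>e\<in>E. \<mu> e ^ q / \<mu> e * (a e \<bullet> e))"
    by (rule tr_comp_spec[OF lina])
  finally show ?thesis by (simp add: sum.distrib sum_distrib_left)
qed

text \<open>Averaging replaces \<open>a i e \<bullet> e\<close> by \<open>\<alpha>\<close>, so the
  eigenvector \<open>e\<close> contributes
  \<open>(1 + \<kappa> / \<mu> e * \<alpha>) * \<mu> e ^ q\<close>. The alternatives in
  \<open>side\<close> are the two ways to ensure \<open>\<kappa> / \<mu> e \<le> \<kappa>\<close>;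
  they serve \<open>\<sigma> = 1\<close> and \<open>\<sigma> = -1\<close> respectively.\<close>

lemma weighted_sum_tr_funpow_perturbation_le:
  fixes W :: "'a::euclidean_space \<Rightarrow> 'a"
  assumes W: "adj W W" and W_ge: "\<And>x. w * (x \<bullet> x) \<le> W x \<bullet> x" and w: "0 < w"
    and side: "0 \<le> \<kappa> \<and> (\<forall>x. x \<bullet> x \<le> W x \<bullet> x) \<or> \<kappa> \<le> 0 \<and> (\<forall>x. W x \<bullet> x \<le> x \<bullet> x)"
    and lam: "\<And>i. i \<in> I \<Longrightarrow> 0 \<le> lam i" "sum lam I = 1"
    and a: "\<And>i. i \<in> I \<Longrightarrow> adj (a i) (a i)"
    and a_nonneg: "\<And>i x. i \<in> I \<Longrightarrow> 0 \<le> a i x \<bullet> x"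
    and a_le: "\<And>i x. i \<in> I \<Longrightarrow> a i x \<bullet> x \<le> w * \<tau> * (x \<bullet> x)"
    and mean: "\<And>x. (\<Sum>i\<in>I. lam i *\<^sub>R a i x) = \<alpha> *\<^sub>R x" and \<alpha>: "0 \<le> \<alpha>"
    and q: "q = 2 ^ k"
    and \<kappa>: "\<And>t. 0 \<le> t \<Longrightarrow> t \<le> \<tau> \<Longrightarrow> (1 + \<sigma> * t) ^ q \<le> 1 + \<kappa> * t"
  shows "(\<Sum>i\<in>I. lam i * tr ((\<lambda>x. W x + \<sigma> *\<^sub>R a i x) ^^ q)) \<le> (1 + \<kappa> * \<alpha>) * tr (W ^^ q)"
proof -
  obtain E \<mu> where E: "orthonormal_basis E" and W_spec: "W = spec E \<mu>"
    and \<mu>: "\<And>e. e \<in> E \<Longrightarrow> \<mu> e = W e \<bullet> e"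
    using selfadj_obtain_spec[OF W] by blast
  have ee: "e \<bullet> e = 1" if "e \<in> E" for e using orthonormal_basis_inner[OF E that that] by simp
  have \<mu>_ge: "w \<le> \<mu> e" if "e \<in> E" for e using W_ge[of e] by (simp add: \<mu> ee that)
  have pos: "0 < \<mu> e" if "e \<in> E" for e using \<mu>_ge[OF that] w by simp
  have mean': "(\<Sum>i\<in>I. lam i * (a i e \<bullet> e)) = \<alpha>" if "e \<in> E" for e
    using arg_cong[OF mean[of e], of "\<lambda>x. x \<bullet> e"] by (simp add: inner_sum_left ee that)
  have "(\<Sum>i\<in>I. lam i * tr ((\<lambda>x. W x + \<sigma> *\<^sub>R a i x) ^^ q)) \<le>
    (\<Sum>i\<in>I. lam i * (\<Sum>e\<in>E. \<mu> e ^ q + \<kappa> * (\<mu> e ^ q / \<mu> e * (a i e \<bullet> e))))"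
    unfolding W_spec
    by (intro sum_mono mult_left_mono tr_funpow_perturbation_le[OF E _ w, where \<tau> = \<tau> and k = k])
      (use a a_nonneg a_le q \<kappa> lam \<mu>_ge in auto)
  also have "\<dots> = (\<Sum>e\<in>E. \<Sum>i\<in>I. lam i * (\<mu> e ^ q + \<kappa> * (\<mu> e ^ q / \<mu> e * (a i e \<bullet> e))))"
    unfolding sum_distrib_left by (rule sum.swap)
  also have "\<dots> = (\<Sum>e\<in>E. sum lam I * \<mu> e ^ q + \<kappa> * (\<mu> e ^ q / \<mu> e * (\<Sum>i\<in>I. lam i * (a i e \<bullet> e))))"
    by (intro sum.cong refl)
      (simp add: distrib_left sum.distrib sum_distrib_left sum_distrib_right mult_ac)
  also have "\<dots> = (\<Sum>e\<in>E. (1 + \<kappa> / \<mu> e * \<alpha>) * \<mu> e ^ q)"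
    by (intro sum.cong refl) (simp add: mean' lam(2) algebra_simps)
  also have "\<dots> \<le> (\<Sum>e\<in>E. (1 + \<kappa> * \<alpha>) * \<mu> e ^ q)"
  proof (intro sum_mono mult_right_mono add_left_mono \<alpha>)
    fix e assume e: "e \<in> E"
    from side show "\<kappa> / \<mu> e \<le> \<kappa>"
    proof (elim disjE conjE)
      assume "0 \<le> \<kappa>" "\<forall>x. x \<bullet> x \<le> W x \<bullet> x"
      then show ?thesis
        using mult_left_mono[of 1 "\<mu> e" \<kappa>] e pos[OF e]
        by (simp add: \<mu>[OF e, symmetric] ee[OF e] field_simps)
          (metis \<mu> ee e mult.right_neutral mult_left_mono)
    next
      assume "\<kappa> \<le> 0" "\<forall>x. W x \<bullet> x \<le> x \<bullet> x"
      then have "\<kappa> * 1 \<le> \<kappa> * \<mu> e"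
        by (intro mult_left_mono_neg) (use \<mu> ee e in metis)+
      then show ?thesis using pos[OF e] by (simp add: field_simps)
    qed
  qed (use pos in \<open>auto intro: less_imp_le\<close>)
  also have "\<dots> = (1 + \<kappa> * \<alpha>) * tr (W ^^ q)"
    unfolding W_spec spec_funpow[OF E] tr_eq_sum_orthonormal_basis[OF E linear_spec]
    by (simp add: sum_distrib_left spec_on_basis[OF E] ee)
  finally show ?thesis .
qed

text \<open>The form at a unit vector is at most the largest eigenvalue, whose power is one of the
  nonnegative summands of the trace. This reads a norm bound off the potential at the end.\<close>

lemma power_inner_le_tr_funpow:
  fixes W :: "'a::euclidean_space \<Rightarrow> 'a"
  assumes W: "adj W W" and x: "norm x = 1" and nonneg: "\<And>y. 0 \<le> W y \<bullet> y"
  shows "(W x \<bullet> x) ^ q \<le> tr (W ^^ q)"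
proof -
  obtain E \<mu> where E: "orthonormal_basis E" and W_spec: "W = spec E \<mu>"
    and \<mu>: "\<And>e. e \<in> E \<Longrightarrow> \<mu> e = W e \<bullet> e"
    using selfadj_obtain_spec[OF W] by blast
  have ee: "e \<bullet> e = 1" if "e \<in> E" for e using orthonormal_basis_inner[OF E that that] by simp
  have \<mu>0: "0 \<le> \<mu> e" if "e \<in> E" for e by (simp add: \<mu> that nonneg)
  have fin: "finite E" by (rule finite_orthonormal_basis[OF E])
  have xx: "(\<Sum>e\<in>E. (x \<bullet> e)\<^sup>2) = 1"
    using x by (simp add: norm_eq_sum_orthonormal_basis[OF E, symmetric] norm_eq_sqrt_inner)
  have "E \<noteq> {}" using xx by auto
  define m where "m = Max (\<mu> ` E)"
  have m: "m \<in> \<mu> ` E" "\<And>e. e \<in> E \<Longrightarrow> \<mu> e \<le> m"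
    using fin \<open>E \<noteq> {}\<close> by (auto simp: m_def)
  then obtain e where e: "e \<in> E" "m = \<mu> e" by blast
  have "W x \<bullet> x \<le> (\<Sum>e\<in>E. m * (x \<bullet> e)\<^sup>2)"
    unfolding W_spec inner_spec by (intro sum_mono mult_right_mono m) auto
  also have "\<dots> = m" by (simp add: sum_distrib_left[symmetric] xx)
  finally have "(W x \<bullet> x) ^ q \<le> \<mu> e ^ q"
    by (auto simp: e intro!: power_mono nonneg)
  also have "\<dots> \<le> (\<Sum>e\<in>E. \<mu> e ^ q)"
    using fin e by (intro member_le_sum zero_le_power \<mu>0) auto
  also have "\<dots> = tr (W ^^ q)"
    unfolding W_spec spec_funpow[OF E] tr_eq_sum_orthonormal_basis[OF E linear_spec]
    by (simp add: spec_on_basis[OF E] ee)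
  finally show ?thesis .
qed

subsection \<open>Choosing the indices\<close>

text \<open>With \<open>y = q t\<close> the power is at most \<open>exp y \<le> 1 + y + y^2\<close>,
  and \<open>y \<le> \<beta>\<close> makes the quadratic term linear.\<close>

lemma one_plus_power_le_linear:
  fixes t \<beta> :: real
  assumes "0 < q" "\<beta> \<le> 1" "0 \<le> t" "t \<le> \<beta> / real q"
  shows "(1 + t) ^ q \<le> 1 + real q * (1 + \<beta>) * t"
proof -
  have y: "0 \<le> real q * t" "real q * t \<le> \<beta>" using assms by (simp_all add: field_simps)
  have "(1 + t) ^ q \<le> exp t ^ q"
    using assms exp_ge_add_one_self[of t] by (intro power_mono) auto
  also have "\<dots> = exp (real q * t)" by (simp add: exp_of_nat_mult)
  also have "\<dots> \<le> 1 + real q * t + (real q * t)\<^sup>2" using y assms by (intro exp_bound) auto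
  also have "(real q * t)\<^sup>2 \<le> \<beta> * (real q * t)"
    unfolding power2_eq_square using y by (intro mult_right_mono)
  finally show ?thesis by (simp add: algebra_simps)
qed

text \<open>The range of \<open>t\<close> is twice that of \<open>one_plus_power_le_linear\<close>,
  since for \<open>\<sigma> = -1\<close> the operator is only bounded below by 1/2. The coefficient
  1/2 in \<open>exp (- y) \<le> 1 - y + y^2 / 2\<close> compensates for this.\<close>

lemma one_minus_power_le_linear:
  fixes t \<beta> :: real
  assumes "0 < q" "2 * \<beta> \<le> 1" "0 \<le> t" "t \<le> 2 * \<beta> / real q"
  shows "(1 - t) ^ q \<le> 1 + real q * (\<beta> - 1) * t"
proof -
  define y where "y = real q * t"
  have y: "0 \<le> y" "y \<le> 2 * \<beta>" using assms by (simp_all add: y_def field_simps)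
  \<comment> \<open>Together with \<open>y \<le> 2 * \<beta> \<le> 1\<close> this gives
    \<open>t \<le> 1\<close>, so the base \<open>1 - t\<close> is nonnegative and powers are
    monotone.\<close>
  have "t \<le> y" using assms mult_right_mono[of 1 "real q" t] by (simp add: y_def)
  then have "(1 - t) ^ q \<le> exp (- t) ^ q"
    using y assms exp_ge_add_one_self[of "- t"] by (intro power_mono) auto
  also have "\<dots> = 1 / exp y" by (simp add: y_def exp_of_nat_mult[symmetric] exp_minus field_simps)
  also have "\<dots> \<le> 1 / (1 + y + y\<^sup>2 / 2)"
    using y exp_lower_Taylor_quadratic[of y] by (intro divide_left_mono) (auto simp: add_pos_nonneg)
  also have "\<dots> \<le> 1 - y + y\<^sup>2 / 2"
  proof -
    have "(1 - y + y\<^sup>2 / 2) * (1 + y + y\<^sup>2 / 2) = 1 + y ^ 4 / 4"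
      by (simp add: algebra_simps power2_eq_square power4_eq_xxxx)
    then have "1 \<le> (1 - y + y\<^sup>2 / 2) * (1 + y + y\<^sup>2 / 2)" by simp
    moreover have "0 < 1 + y + y\<^sup>2 / 2" using y by (simp add: add_pos_nonneg)
    ultimately show ?thesis by (simp add: pos_divide_le_eq)
  qed
  also have "y\<^sup>2 / 2 \<le> \<beta> * y"
    using mult_right_mono[OF y(2) y(1)] by (simp add: power2_eq_square)
  finally show ?thesis by (simp add: y_def algebra_simps)
qed

lemma exists_le_weighted_mean:
  fixes f :: "'i \<Rightarrow> real"
  assumes lam: "\<And>i. i \<in> I \<Longrightarrow> 0 \<le> lam i" "sum lam I = 1" and le: "(\<Sum>i\<in>I. lam i * f i) \<le> c"
  shows "\<exists>i\<in>I. f i \<le> c"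
proof (rule ccontr)
  assume "\<not> (\<exists>i\<in>I. f i \<le> c)"
  then have gt: "c < f i" if "i \<in> I" for i using that by force
  have "finite I" using lam(2) sum.infinite[of I lam] by force
  obtain j where j: "j \<in> I" "lam j \<noteq> 0"
    using lam(2) by (metis sum.neutral zero_neq_one)
  have "(\<Sum>i\<in>I. lam i * c) < (\<Sum>i\<in>I. lam i * f i)"
    using \<open>finite I\<close>
  proof (rule sum_strict_mono_ex1)
    show "\<forall>i\<in>I. lam i * c \<le> lam i * f i"
      using mult_left_mono[OF less_imp_le[OF gt] lam(1)] by blast
    show "\<exists>i\<in>I. lam i * c < lam i * f i"
      using j gt[OF j(1)] lam(1)[OF j(1)] by (intro bexI[of _ j]) auto
  qed
  with le show False by (simp add: sum_distrib_right[symmetric] lam(2))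
qed

text \<open>Finitely many strict inequalities against exponentials thus survive replacing the
  exponentials by powers with one common exponent \<open>2 ^ k\<close>.\<close>

lemma eventually_power_exp_limit_gt:
  fixes a c :: real
  assumes "c < exp a"
  shows "\<forall>\<^sub>F k in sequentially. c < (1 + a / real (2 ^ k)) ^ (2 ^ k)"
proof -
  have "filterlim (\<lambda>k. 2 ^ k :: nat) at_top sequentially"
    by (rule filterlim_subseq) (simp add: strict_mono_def)
  with tendsto_exp_limit_sequentially[of a]
  have "(\<lambda>k. (1 + a / real (2 ^ k)) ^ (2 ^ k)) \<longlonglongrightarrow> exp a"
    by (rule filterlim_compose)
  then show ?thesis using assms by (rule order_tendstoD(1))
qed

theorem exists_sum_approximating_mean:
  fixes A :: "'i \<Rightarrow> 'a::euclidean_space \<Rightarrow> 'a" and M \<epsilon> :: real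
  assumes lam: "\<And>i. i \<in> I \<Longrightarrow> 0 \<le> lam i" "sum lam I = 1"
    and A: "\<And>i. i \<in> I \<Longrightarrow> adj (A i) (A i)"
    and A_nonneg: "\<And>i x. i \<in> I \<Longrightarrow> 0 \<le> A i x \<bullet> x"
    and A_le: "\<And>i x. i \<in> I \<Longrightarrow> A i x \<bullet> x \<le> M * (x \<bullet> x)"
    and mean: "\<And>x. (\<Sum>i\<in>I. lam i *\<^sub>R A i x) = x"
    and \<epsilon>: "0 < \<epsilon>" "\<epsilon> \<le> 1"
    and N: "4 * M * ln (2 * real DIM('a)) < real N * \<epsilon>\<^sup>2"
  shows "\<exists>idx :: nat \<Rightarrow> 'i. (\<forall>r. idx r \<in> I) \<and>
    (\<forall>x. \<bar>(\<Sum>r=1..N. A (idx r) x) \<bullet> x - real N * (x \<bullet> x)\<bar> \<le> real N * \<epsilon> * (x \<bullet> x))"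
proof -
  obtain b :: 'a where b: "norm b = 1" using norm_Basis[OF SOME_Basis] by blast
  have bb: "b \<bullet> b = 1" using b by (simp add: norm_eq_sqrt_inner)
  have "1 = (\<Sum>i\<in>I. lam i * (A i b \<bullet> b))"
    using arg_cong[OF mean[of b], of "\<lambda>x. x \<bullet> b"] by (simp add: inner_sum_left bb)
  also have "\<dots> \<le> (\<Sum>i\<in>I. lam i * M)"
    using A_le[of _ b] lam by (intro sum_mono mult_left_mono) (auto simp: bb)
  finally have M: "1 \<le> M" by (simp add: sum_distrib_right[symmetric] lam(2))
  define D where "D = real DIM('a)"
  have D: "1 \<le> D" using DIM_positive[where 'a='a] by (simp add: D_def del: DIM_positive)
  \<comment> \<open>Per step the exponent of the threshold exceeds that of the growth bound by
    \<open>\<theta> (\<epsilon> - \<beta>) = \<epsilon>^2 / (4 M)\<close>. Over \<open>N\<close>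
    steps this beats \<open>ln (2 * D)\<close>, where \<open>2 * D\<close> is the initial sum of the
    potentials; this is exactly the hypothesis on \<open>N\<close>.\<close>
  define \<theta> \<beta> where "\<theta> = \<epsilon> / (2 * M)" and "\<beta> = \<theta> * M"
  have \<beta>: "\<beta> = \<epsilon> / 2" using M by (simp add: \<beta>_def \<theta>_def)
  have \<theta>: "0 < \<theta>" "\<theta> \<le> 1 / 2" using M \<epsilon> by (simp_all add: \<theta>_def field_simps)
  have exp_gt: "2 * D * exp (\<theta> * (\<sigma> + \<beta>)) ^ N < exp (\<theta> * N * (\<sigma> + \<epsilon>))" for \<sigma> :: real
  proof -
    have "ln (2 * D) < \<theta> * N * (\<epsilon> / 2)"
      using N M by (simp add: D_def \<theta>_def field_simps power2_eq_square)
    then have "ln (2 * D) + N * (\<theta> * (\<sigma> + \<beta>)) < \<theta> * N * (\<sigma> + \<epsilon>)"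
      by (simp add: \<beta> algebra_simps)
    then have "exp (ln (2 * D) + N * (\<theta> * (\<sigma> + \<beta>))) < exp (\<theta> * N * (\<sigma> + \<epsilon>))" by simp
    then show ?thesis using D by (simp add: exp_add exp_of_nat_mult)
  qed
  \<comment> \<open>This size of \<open>q\<close> makes \<open>h * (N * M) \<le> 1 / 2\<close>,
    which keeps \<open>W (-1) S\<close> above 1/2 for every partial sum \<open>S\<close>.\<close>
  have "\<forall>\<^sub>F k in sequentially. 2 * \<theta> * N * M \<le> real (2 ^ k)"
    using eventually_compose_filterlim[OF eventually_ge_at_top
        filterlim_compose[OF filterlim_real_sequentially filterlim_subseq[of "\<lambda>k. 2 ^ k :: nat"]]]
    by (simp add: strict_mono_def)
  then have "\<forall>\<^sub>F k in sequentially. 2 * \<theta> * N * M \<le> real (2 ^ k) \<and>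
      (\<forall>\<sigma>\<in>{1, -1}. 2 * D * exp (\<theta> * (\<sigma> + \<beta>)) ^ N
        < (1 + \<theta> * N * (\<sigma> + \<epsilon>) / real (2 ^ k)) ^ (2 ^ k))"
    using eventually_power_exp_limit_gt[OF exp_gt]
    by (intro eventually_conj eventually_ball_finite) auto
  then obtain k where k: "2 * \<theta> * N * M \<le> real (2 ^ k)"
    "\<And>\<sigma>. \<sigma> \<in> {1, -1} \<Longrightarrow> 2 * D * exp (\<theta> * (\<sigma> + \<beta>)) ^ N
        < (1 + \<theta> * N * (\<sigma> + \<epsilon>) / real (2 ^ k)) ^ (2 ^ k)"
    using eventually_happens'[OF sequentially_bot] by blast
  define q where "q = (2 ^ k :: nat)"
  have q: "0 < q" "2 * \<theta> * N * M \<le> real q" using k(1) by (simp_all add: q_def)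
  define h where "h = \<theta> / q"
  have h: "0 < h" "h * (N * M) \<le> 1 / 2"
    using \<theta> q by (simp_all add: h_def field_simps)
  define W where "W \<sigma> S = (\<lambda>x. x + (\<sigma> * h) *\<^sub>R S x)" for \<sigma> and S :: "'a \<Rightarrow> 'a"
  define pot where "pot \<sigma> S = tr (W \<sigma> S ^^ q)" for \<sigma> and S :: "'a \<Rightarrow> 'a"
  define F where "F \<sigma> = 1 + \<theta> * (\<sigma> + \<beta>)" for \<sigma>
  define admissible where "admissible S \<longleftrightarrow> adj S S \<and>
    (\<forall>x. 0 \<le> S x \<bullet> x \<and> S x \<bullet> x \<le> N * M * (x \<bullet> x))" for S :: "'a \<Rightarrow> 'a"
  have F_pos: "0 < F \<sigma>" if "\<sigma> \<in> {1, -1}" for \<sigma>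
    using that \<theta> mult_pos_pos[OF \<epsilon>(1) \<theta>(1)] by (auto simp: F_def \<beta> algebra_simps)
  have adjW: "adj (W \<sigma> S) (W \<sigma> S)" if "admissible S" for \<sigma> S
    using that adj_add_scaleR[OF adj_id, of S "\<sigma> * h"] by (simp add: W_def admissible_def)
  have hS: "0 \<le> h * (S x \<bullet> x)" "h * (S x \<bullet> x) \<le> 1 / 2 * (x \<bullet> x)" if "admissible S" for S x
  proof -
    have "0 \<le> S x \<bullet> x" "S x \<bullet> x \<le> N * M * (x \<bullet> x)" using that by (auto simp: admissible_def)
    then show "0 \<le> h * (S x \<bullet> x)" using h by simp
    have "h * (S x \<bullet> x) \<le> h * (N * M * (x \<bullet> x))"
      using h \<open>S x \<bullet> x \<le> _\<close> by (intro mult_left_mono) auto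
    also have "\<dots> = h * (N * M) * (x \<bullet> x)" by simp
    also have "\<dots> \<le> 1 / 2 * (x \<bullet> x)" using h by (intro mult_right_mono) auto
    finally show "h * (S x \<bullet> x) \<le> 1 / 2 * (x \<bullet> x)" .
  qed
  have W_form: "W \<sigma> S x \<bullet> x = x \<bullet> x + \<sigma> * (h * (S x \<bullet> x))" for \<sigma> S x
    by (simp add: W_def inner_add_left)
  have W_nonneg: "0 \<le> W \<sigma> S x \<bullet> x" if "admissible S" "\<sigma> \<in> {1, -1}" for \<sigma> S x
    using hS[OF that(1), of x] inner_ge_zero[of x] that(2) by (auto simp: W_form)
  have pot_ge: "(W \<sigma> S x \<bullet> x) ^ q \<le> pot \<sigma> S"
    if "admissible S" "\<sigma> \<in> {1, -1}" "norm x = 1" for \<sigma> S x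
    unfolding pot_def using that by (intro power_inner_le_tr_funpow adjW W_nonneg)
  have step: "(\<Sum>i\<in>I. lam i * pot \<sigma> (\<lambda>x. S x + A i x)) \<le> F \<sigma> * pot \<sigma> S"
    if S: "admissible S" and \<sigma>: "\<sigma> \<in> {1, -1}" for \<sigma> S
  proof -
    have shift: "W \<sigma> (\<lambda>x. S x + A i x) = (\<lambda>x. W \<sigma> S x + \<sigma> *\<^sub>R (h *\<^sub>R A i x))" for i
      by (simp add: W_def scaleR_add_right fun_eq_iff)
    have mean': "(\<Sum>i\<in>I. lam i *\<^sub>R (h *\<^sub>R A i x)) = h *\<^sub>R x" for x
      using arg_cong[OF mean[of x], of "\<lambda>x. h *\<^sub>R x"]
      by (simp add: scaleR_sum_right mult.commute)
    have A_le': "h *\<^sub>R A i x \<bullet> x \<le> \<beta> / q * (x \<bullet> x)" if "i \<in> I" for i x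
      using mult_left_mono[OF A_le[OF that], of h x] h by (simp add: h_def \<beta>_def)
    \<comment> \<open>The lower bound for the form of \<open>W \<sigma> S\<close>. The choice
      \<open>\<tau> = \<beta> / (w * q)\<close> makes \<open>w * \<tau>\<close> equal to
      \<open>\<beta> / q = h * M\<close>, the bound for the increment; so \<open>t\<close> ranges up
      to \<open>\<beta> / q\<close> or \<open>2 * \<beta> / q\<close> according to the sign.\<close>
    define w where "w = (if \<sigma> = 1 then 1 else 1 / 2 :: real)"
    have "(\<Sum>i\<in>I. lam i * pot \<sigma> (\<lambda>x. S x + A i x)) \<le> (1 + real q * (\<sigma> + \<beta>) * h) * pot \<sigma> S"
      unfolding pot_def shift
    proof (rule weighted_sum_tr_funpow_perturbation_le[where w = w and \<tau> = "\<beta> / (w * q)"])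
      show "w * (x \<bullet> x) \<le> W \<sigma> S x \<bullet> x" for x
        using hS[OF S, of x] \<sigma> by (auto simp: W_form w_def)
      show "0 \<le> real q * (\<sigma> + \<beta>) \<and> (\<forall>x. x \<bullet> x \<le> W \<sigma> S x \<bullet> x) \<or>
        real q * (\<sigma> + \<beta>) \<le> 0 \<and> (\<forall>x. W \<sigma> S x \<bullet> x \<le> x \<bullet> x)"
        using hS[OF S] \<sigma> \<epsilon> by (auto simp: W_form \<beta> mult_le_0_iff)
      show "(1 + \<sigma> * t) ^ q \<le> 1 + real q * (\<sigma> + \<beta>) * t" if "0 \<le> t" "t \<le> \<beta> / (w * q)" for t
        using that \<sigma> q \<epsilon> one_plus_power_le_linear[of q \<beta> t] one_minus_power_le_linear[of q \<beta> t]
        by (auto simp: w_def \<beta> algebra_simps)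
      show "h *\<^sub>R A i x \<bullet> x \<le> w * (\<beta> / (w * q)) * (x \<bullet> x)" if "i \<in> I" for i x
        using A_le'[OF that, of x] by (simp add: w_def split: if_splits)
    qed (use lam A A_nonneg h mean' q_def adjW[OF S] in \<open>auto simp: w_def intro: adj_scaleR\<close>)
    also have "1 + real q * (\<sigma> + \<beta>) * h = F \<sigma>" using q by (simp add: F_def h_def)
    finally show ?thesis .
  qed
  let ?S = "\<lambda>idx n x. \<Sum>r=1..n. A (idx r) x"
  have adm: "admissible (?S idx n)" if "\<forall>r. idx r \<in> I" "n \<le> N" for idx n
  proof -
    have "(\<Sum>r=1..n. A (idx r) x \<bullet> x) \<le> N * M * (x \<bullet> x)" for x
    proof -
      have "(\<Sum>r=1..n. A (idx r) x \<bullet> x) \<le> (\<Sum>r=1..n. M * (x \<bullet> x))"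
        using that by (intro sum_mono A_le) auto
      also have "\<dots> \<le> N * (M * (x \<bullet> x))" using that M by (auto intro!: mult_right_mono)
      finally show ?thesis by simp
    qed
    then show ?thesis unfolding admissible_def
      using that A A_nonneg by (auto intro!: adj_sum sum_nonneg simp: inner_sum_left)
  qed
  \<comment> \<open>Each potential is divided by its own growth factor, so the sum does not increase
    in the mean and a single choice of index controls both signs.\<close>
  have "\<exists>idx. (\<forall>r. idx r \<in> I) \<and>
    pot 1 (?S idx n) / F 1 ^ n + pot (-1) (?S idx n) / F (-1) ^ n \<le> 2 * D" if "n \<le> N" for n
    using that
  proof (induction n)
    case 0
    obtain i where "i \<in> I" using lam(2) by fastforce
    moreover have "pot \<sigma> (\<lambda>x. 0) = D" for \<sigma>
    proof -
      have "W \<sigma> (\<lambda>x. 0) = id" by (simp add: W_def fun_eq_iff)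
      then have "pot \<sigma> (\<lambda>x. 0) = tr (id :: 'a \<Rightarrow> 'a)" by (simp add: pot_def)
      then show ?thesis by (simp add: tr_def D_def)
    qed
    \<comment> \<open>Every value of \<open>idx\<close> must lie in \<open>I\<close>, so a constant
      placeholder fills the positions not yet chosen.\<close>
    ultimately show ?case by (intro exI[of _ "\<lambda>_. i"]) simp
  next
    case (Suc n)
    then obtain idx where idx: "\<forall>r. idx r \<in> I"
      and le: "pot 1 (?S idx n) / F 1 ^ n + pot (-1) (?S idx n) / F (-1) ^ n \<le> 2 * D"
      by auto
    let ?T = "\<lambda>i x. ?S idx n x + A i x"
    have S: "admissible (?S idx n)" using adm[OF idx] Suc.prems by simp
    have step': "(\<Sum>i\<in>I. lam i * (pot \<sigma> (?T i) / F \<sigma> ^ Suc n)) \<le> pot \<sigma> (?S idx n) / F \<sigma> ^ n"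
      if "\<sigma> \<in> {1, -1}" for \<sigma>
    proof -
      have "(\<Sum>i\<in>I. lam i * (pot \<sigma> (?T i) / F \<sigma> ^ Suc n)) =
        (\<Sum>i\<in>I. lam i * pot \<sigma> (?T i)) / F \<sigma> ^ Suc n"
        by (simp add: sum_divide_distrib)
      also have "\<dots> \<le> F \<sigma> * pot \<sigma> (?S idx n) / F \<sigma> ^ Suc n"
        using F_pos[OF that] by (intro divide_right_mono step S that) auto
      also have "\<dots> = pot \<sigma> (?S idx n) / F \<sigma> ^ n" using F_pos[OF that] by simp
      finally show ?thesis .
    qed
    have "(\<Sum>i\<in>I. lam i * (pot 1 (?T i) / F 1 ^ Suc n + pot (-1) (?T i) / F (-1) ^ Suc n)) \<le> 2 * D"
      using step'[of 1] step'[of "-1"] le by (simp add: distrib_left sum.distrib del: power_Suc)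
    from exists_le_weighted_mean[OF lam this] obtain i where i: "i \<in> I"
      "pot 1 (?T i) / F 1 ^ Suc n + pot (-1) (?T i) / F (-1) ^ Suc n \<le> 2 * D"
      by blast
    have "?S (idx(Suc n := i)) (Suc n) = ?T i"
      by (auto simp: fun_eq_iff intro!: sum.cong)
    with i idx show ?case by (intro exI[of _ "idx(Suc n := i)"]) auto
  qed
  then obtain idx where idx: "\<forall>r. idx r \<in> I"
    and le: "pot 1 (?S idx N) / F 1 ^ N + pot (-1) (?S idx N) / F (-1) ^ N \<le> 2 * D"
    by blast
  let ?s = "?S idx N"
  have S: "admissible ?s" using adm[OF idx] by simp
  have pot_nonneg: "0 \<le> pot \<sigma> ?s / F \<sigma> ^ N" if "\<sigma> \<in> {1, -1}" for \<sigma>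
    using order_trans[OF zero_le_power[OF W_nonneg[OF S that]] pot_ge[OF S that b]] F_pos[OF that]
    by simp
  have pot_le: "pot \<sigma> ?s \<le> 2 * D * exp (\<theta> * (\<sigma> + \<beta>)) ^ N" if \<sigma>: "\<sigma> \<in> {1, -1}" for \<sigma>
  proof -
    have "pot \<sigma> ?s / F \<sigma> ^ N \<le> 2 * D"
      using le pot_nonneg[of 1] pot_nonneg[of "-1"] \<sigma> by auto
    then have "pot \<sigma> ?s \<le> 2 * D * F \<sigma> ^ N" using F_pos[OF \<sigma>] by (simp add: pos_divide_le_eq)
    also have "\<dots> \<le> 2 * D * exp (\<theta> * (\<sigma> + \<beta>)) ^ N"
      using D F_pos[OF \<sigma>] exp_ge_add_one_self[of "\<theta> * (\<sigma> + \<beta>)"]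
      by (intro mult_left_mono power_mono) (auto simp: F_def)
    finally show ?thesis .
  qed
  \<comment> \<open>A violation would push the form of \<open>W \<sigma> ?s\<close> at
    \<open>x\<close> to at least \<open>1 + \<theta> * N * (\<sigma> + \<epsilon>) / q\<close>,
    whose \<open>q\<close>-th power exceeds the bound on the potential by the choice of
    \<open>k\<close>.\<close>
  have unit: "\<sigma> * (?s x \<bullet> x - N) \<le> N * \<epsilon>" if \<sigma>: "\<sigma> \<in> {1, -1}" and x: "norm x = 1" for \<sigma> x
  proof (rule ccontr)
    assume "\<not> ?thesis"
    then have "N * (\<sigma> + \<epsilon>) \<le> \<sigma> * (?s x \<bullet> x)" using \<sigma> by (auto simp: algebra_simps)
    then have "h * (N * (\<sigma> + \<epsilon>)) \<le> h * (\<sigma> * (?s x \<bullet> x))"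
      using h by (intro mult_left_mono) auto
    then have "1 + \<theta> * N * (\<sigma> + \<epsilon>) / q \<le> W \<sigma> ?s x \<bullet> x"
      using x by (simp add: W_form norm_eq_sqrt_inner h_def mult_ac)
    \<comment> \<open>Monotonicity of powers needs a nonnegative base; for
      \<open>\<sigma> = -1\<close> the numerator may be negative, but it is at least
      \<open>- (\<theta> * N * M)\<close>.\<close>
    moreover have "0 \<le> 1 + \<theta> * N * (\<sigma> + \<epsilon>) / q"
    proof -
      have "\<theta> * N * (- (\<sigma> + \<epsilon>)) \<le> \<theta> * N * M" using \<sigma> \<theta> \<epsilon> M by (intro mult_left_mono) auto
      moreover have "0 \<le> \<theta> * N * M" using \<theta> M by simp
      ultimately have "- (\<theta> * N * (\<sigma> + \<epsilon>)) \<le> q" using q by (simp add: algebra_simps)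
      then show ?thesis using q by (simp add: field_simps)
    qed
    ultimately have "(1 + \<theta> * N * (\<sigma> + \<epsilon>) / q) ^ q \<le> (W \<sigma> ?s x \<bullet> x) ^ q" by (intro power_mono)
    also have "\<dots> \<le> 2 * D * exp (\<theta> * (\<sigma> + \<beta>)) ^ N"
      using pot_ge[OF S \<sigma> x] pot_le[OF \<sigma>] by simp
    finally show False using k(2)[OF \<sigma>] by (simp add: q_def)
  qed
  have "\<bar>?s x \<bullet> x - N * (x \<bullet> x)\<bar> \<le> N * \<epsilon> * (x \<bullet> x)" for x
  proof (cases "x = 0")
    case False
    define u where "u = x /\<^sub>R norm x"
    have u: "norm u = 1" "x = norm x *\<^sub>R u" using False by (simp_all add: u_def)
    have lin: "linear ?s" using S adj_linear by (auto simp: admissible_def)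
    have "?s x \<bullet> x = (x \<bullet> x) * (?s u \<bullet> u)"
      by (subst u(2), subst (2) u(2))
        (simp only: linear_cmul[OF lin] inner_scaleR_left inner_scaleR_right
          power2_norm_eq_inner[symmetric] power2_eq_square mult.assoc)
    then have "?s x \<bullet> x - N * (x \<bullet> x) = (x \<bullet> x) * (?s u \<bullet> u - N)"
      by (simp only: right_diff_distrib mult.commute)
    then have "\<bar>?s x \<bullet> x - N * (x \<bullet> x)\<bar> = (x \<bullet> x) * \<bar>?s u \<bullet> u - N\<bar>"
      by (simp only: abs_mult abs_of_nonneg[OF inner_ge_zero])
    also have "\<dots> \<le> (x \<bullet> x) * (N * \<epsilon>)"
      using unit[OF _ u(1), of 1] unit[OF _ u(1), of "-1"] by (intro mult_left_mono) auto
    finally show ?thesis by (simp add: mult_ac)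
  qed simp
  with idx show ?thesis by blast
qed

subsection \<open>Matrices\<close>

text \<open>Polarisation: \<open>4 * (f x \<bullet> y)\<close> is the form at \<open>x + y\<close>
  minus that at \<open>x - y\<close>, so the parallelogram law bounds it by
  \<open>2 * c * (x \<bullet> x + y \<bullet> y)\<close>. Taking \<open>y\<close> as
  \<open>f x\<close> rescaled to the length of \<open>x\<close> gives the norm bound.\<close>

lemma onorm_le_if_quadratic_form_le:
  fixes f :: "'a::euclidean_space \<Rightarrow> 'a"
  assumes f: "adj f f" and le: "\<And>x. \<bar>f x \<bullet> x\<bar> \<le> c * (x \<bullet> x)"
  shows "onorm f \<le> c"
proof (rule onorm_le)
  fix x
  have lin: "linear f" using f by (rule adj_linear)
  show "norm (f x) \<le> c * norm x"
  proof (cases "f x = 0 \<or> x = 0")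
    case True
    obtain b :: 'a where b: "norm b = 1" using norm_Basis[OF SOME_Basis] by blast
    have "0 \<le> c" using le[of b] b by (simp add: norm_eq_sqrt_inner)
    then show ?thesis using True linear_0[OF lin] by auto
  next
    case False
    define s where "s = norm (f x) / norm x"
    have s: "0 < s" using False by (simp add: s_def)
    define y where "y = f x /\<^sub>R s"
    have "4 * (f x \<bullet> y) = f (x + y) \<bullet> (x + y) - f (x - y) \<bullet> (x - y)"
      using adjD[OF f, of y x]
      by (simp add: linear_add[OF lin] linear_diff[OF lin] inner_add_left inner_add_right
          inner_diff_left inner_diff_right inner_commute)
    also have "\<dots> \<le> c * ((x + y) \<bullet> (x + y)) + c * ((x - y) \<bullet> (x - y))"
      using le[of "x + y"] le[of "x - y"] by linarith
    also have "\<dots> = 2 * c * (x \<bullet> x + y \<bullet> y)"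
      by (simp add: inner_add_left inner_add_right inner_diff_left inner_diff_right
          inner_commute algebra_simps)
    also have "y \<bullet> y = x \<bullet> x"
      using False by (simp add: y_def s_def dot_square_norm power2_eq_square field_simps)
    finally have "f x \<bullet> y \<le> c * (norm x)\<^sup>2" by (simp add: dot_square_norm)
    moreover have "f x \<bullet> y = norm (f x) * norm x"
      using False by (simp add: y_def s_def dot_square_norm power2_eq_square field_simps)
    ultimately show ?thesis using False by (simp add: power2_eq_square)
  qed
qed

text \<open>Here \<open>d\<close> stands for the matrix size, kept apart from the real dimension so
  that \<open>DIM('a) \<le> 2 * d\<close> covers real and complex matrices alike.\<close>

lemma exists_average_near_id:
  fixes A :: "nat \<Rightarrow> 'a::euclidean_space \<Rightarrow> 'a" and M \<epsilon> :: real
  assumes lam: "\<forall>i\<in>I. 0 \<le> lam i" "sum lam I = 1"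
    and A: "\<And>i. i \<in> I \<Longrightarrow> adj (A i) (A i)"
    and A_nonneg: "\<And>i x. i \<in> I \<Longrightarrow> 0 \<le> A i x \<bullet> x"
    and A_le: "\<And>i. i \<in> I \<Longrightarrow> onorm (A i) \<le> M"
    and mean: "\<And>x. (\<Sum>i\<in>I. lam i *\<^sub>R A i x) = x"
    and \<epsilon>: "0 < \<epsilon>" "\<epsilon> \<le> 1" and N: "0 < N"
      "9 * (M * ln (2 * d) / \<epsilon>\<^sup>2) \<le> real N"
    and d: "1 \<le> d" "real DIM('a) \<le> 2 * d"
  shows "\<exists>idx :: nat \<Rightarrow> nat. (\<forall>r\<in>{1..N}. idx r \<in> I) \<and>
    onorm (\<lambda>x. (1 / real N) *\<^sub>R (\<Sum>r=1..N. A (idx r) x) - x) \<le> \<epsilon>"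
proof -
  have le: "A i x \<bullet> x \<le> M * (x \<bullet> x)" if "i \<in> I" for i x
  proof -
    have "bounded_linear (A i)"
      using adj_linear[OF A[OF that]] by (simp add: linear_conv_bounded_linear)
    then have "norm (A i x) \<le> onorm (A i) * norm x" by (rule onorm)
    also have "\<dots> \<le> M * norm x" using A_le[OF that] by (intro mult_right_mono) auto
    finally have "norm (A i x) * norm x \<le> M * norm x * norm x" by (intro mult_right_mono) auto
    then show ?thesis using norm_cauchy_schwarz[of "A i x" x]
      by (simp add: dot_square_norm power2_eq_square)
  qed
  have "0 \<le> M"
  proof -
    obtain i where "i \<in> I" using lam(2) by fastforce
    moreover obtain b :: 'a where b: "norm b = 1" using norm_Basis[OF SOME_Basis] by blast
    ultimately show ?thesis
      using order_trans[OF A_nonneg le, of i b] by (simp add: norm_eq_sqrt_inner)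
  qed
  \<comment> \<open>From \<open>2 * DIM('a) \<le> 4 * d \<le> (2 * d)^2\<close> the required bound
    becomes \<open>8 * M * ln (2 * d)\<close>. The gap between 8 and 9 yields strictness, except
    when the logarithmic term vanishes; then \<open>0 < N * \<epsilon>^2\<close> does.\<close>
  have "ln (2 * real DIM('a)) \<le> ln ((2 * d)\<^sup>2)"
    using d mult_mono[of 2 "2 * d" "real DIM('a)" "2 * d"]
    by (subst ln_le_cancel_iff) (auto simp: power2_eq_square DIM_positive)
  also have "\<dots> = 2 * ln (2 * d)" using d by (subst ln_realpow) auto
  finally have "4 * M * ln (2 * real DIM('a)) \<le> 4 * M * (2 * ln (2 * d))"
    using \<open>0 \<le> M\<close> by (intro mult_left_mono) auto
  moreover have "9 * (M * ln (2 * d)) \<le> N * \<epsilon>\<^sup>2" using N \<epsilon> by (simp add: field_simps)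
  moreover have "0 \<le> M * ln (2 * d)" using \<open>0 \<le> M\<close> d by simp
  moreover have "0 < N * \<epsilon>\<^sup>2" using N \<epsilon> by simp
  ultimately have "4 * M * ln (2 * real DIM('a)) < N * \<epsilon>\<^sup>2" by linarith
  then obtain idx :: "nat \<Rightarrow> nat" where idx: "\<forall>r. idx r \<in> I"
    and sum: "\<And>x. \<bar>(\<Sum>r=1..N. A (idx r) x) \<bullet> x - real N * (x \<bullet> x)\<bar> \<le> real N * \<epsilon> * (x \<bullet> x)"
    using exists_sum_approximating_mean[of I lam A M \<epsilon> N] lam A A_nonneg le mean \<epsilon> by blast
  let ?f = "\<lambda>x. (1 / real N) *\<^sub>R (\<Sum>r=1..N. A (idx r) x) - x"
  have "adj ?f ?f"
    using adj_add_scaleR[OF adj_scaleR[OF adj_sum[of "{1..N}" "\<lambda>r. A (idx r)"]] adj_id,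
        of "1 / real N" "-1"] idx A by simp
  moreover have "\<bar>?f x \<bullet> x\<bar> \<le> \<epsilon> * (x \<bullet> x)" for x
  proof -
    have "?f x \<bullet> x = ((\<Sum>r=1..N. A (idx r) x) \<bullet> x - real N * (x \<bullet> x)) / N"
      using N by (simp add: inner_diff_left field_simps)
    then have "\<bar>?f x \<bullet> x\<bar> = \<bar>(\<Sum>r=1..N. A (idx r) x) \<bullet> x - real N * (x \<bullet> x)\<bar> / N"
      by (simp only: abs_divide abs_of_nat)
    also have "\<dots> \<le> \<epsilon> * (x \<bullet> x)"
      using sum[of x] N(1) by (simp add: divide_le_eq mult_ac)
    finally show ?thesis .
  qed
  ultimately have "onorm ?f \<le> \<epsilon>" by (rule onorm_le_if_quadratic_form_le)
  with idx show ?thesis by blast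
qed

lemma adj_psd_real: "psd_real A \<Longrightarrow> adj ((*v) A) ((*v) A)"
  unfolding adj_def psd_real_def by (metis dot_lmul_matrix transpose_matrix_vector)

text \<open>The inner product on \<open>complex^'d\<close> is the real part of the Hermitian one.
  For it, multiplication by an entry is adjoint to multiplication by the conjugate, which is the
  transposed entry.\<close>

lemma adj_hermitian:
  assumes "hermitian A"
  shows "adj ((*v) A) ((*v) A)"
proof -
  have entry: "(A $ i $ j * z) \<bullet> w = z \<bullet> (A $ j $ i * w)" for i j z w
  proof -
    have "A $ i $ j = cnj (A $ j $ i)" using assms unfolding hermitian_def by blast
    then show ?thesis by (simp add: inner_complex_def algebra_simps)
  qed
  have "(A *v x) \<bullet> y = x \<bullet> (A *v y)" for x y
  proof -
    have "(A *v x) \<bullet> y = (\<Sum>i\<in>UNIV. \<Sum>j\<in>UNIV. (A $ i $ j * x $ j) \<bullet> y $ i)"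
      by (simp add: inner_vec_def matrix_vector_mult_def inner_sum_left)
    also have "\<dots> = (\<Sum>j\<in>UNIV. \<Sum>i\<in>UNIV. x $ j \<bullet> (A $ j $ i * y $ i))"
      unfolding entry by (rule sum.swap)
    also have "\<dots> = x \<bullet> (A *v y)"
      by (simp add: inner_vec_def matrix_vector_mult_def inner_sum_right)
    finally show ?thesis .
  qed
  then show ?thesis by (simp add: adj_def)
qed

lemma inner_psd_complex_nonneg: "psd_complex A \<Longrightarrow> 0 \<le> (A *v x) \<bullet> x"
  by (auto simp: psd_complex_def inner_vec_def inner_complex_def Re_sum algebra_simps)

lemma scaleR_matrix_vector_mult:
  fixes A :: "'a::real_normed_field^'n^'m"
  shows "(c *\<^sub>R A) *v x = c *\<^sub>R (A *v x)"
  by (simp add: matrix_vector_mult_def vec_eq_iff scaleR_sum_right)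

lemma sum_matrix_vector_mult:
  fixes A :: "'i \<Rightarrow> 'a::real_normed_field^'n^'m"
  shows "sum A I *v x = (\<Sum>i\<in>I. A i *v x)"
  by (induction I rule: infinite_finite_induct)
    (simp_all add: matrix_vector_mult_add_rdistrib)

theorem corollary1p1:
  fixes m N :: nat and lam :: "nat \<Rightarrow> real" and M \<epsilon> :: real
  assumes "m \<ge> 1"
    and "\<forall>i\<in>{1..m}. lam i \<ge> 0"
    and "(\<Sum>i=1..m. lam i) = 1"
    and "0 < \<epsilon>" and "\<epsilon> \<le> 1"
    and "N > 0"
    and "real N \<ge> 9 * (M * ln (2 * real CARD('d::finite)) / \<epsilon>\<^sup>2)"
  shows
    "(\<forall>A :: nat \<Rightarrow> complex^'d^'d.
        (\<forall>i\<in>{1..m}. psd_complex (A i)) \<and>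
        (\<Sum>i=1..m. lam i *\<^sub>R A i) = mat 1 \<and>
        (\<forall>i\<in>{1..m}. op_norm (A i) \<le> M) \<longrightarrow>
        (\<exists>idx :: nat \<Rightarrow> nat. (\<forall>r\<in>{1..N}. idx r \<in> {1..m}) \<and>
           op_norm ((1 / real N) *\<^sub>R (\<Sum>r=1..N. A (idx r)) - mat 1) \<le> \<epsilon>))
   \<and> (\<forall>A :: nat \<Rightarrow> real^'d^'d.
        (\<forall>i\<in>{1..m}. psd_real (A i)) \<and>
        (\<Sum>i=1..m. lam i *\<^sub>R A i) = mat 1 \<and>
        (\<forall>i\<in>{1..m}. op_norm (A i) \<le> M) \<longrightarrow>
        (\<exists>idx :: nat \<Rightarrow> nat. (\<forall>r\<in>{1..N}. idx r \<in> {1..m}) \<and>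
           op_norm ((1 / real N) *\<^sub>R (\<Sum>r=1..N. A (idx r)) - mat 1) \<le> \<epsilon>))"
proof (intro conjI allI impI; elim conjE)
  fix A :: "nat \<Rightarrow> complex^'d^'d"
  assume A: "\<forall>i\<in>{1..m}. psd_complex (A i)" "(\<Sum>i=1..m. lam i *\<^sub>R A i) = mat 1"
    "\<forall>i\<in>{1..m}. op_norm (A i) \<le> M"
  have mean: "(\<Sum>i=1..m. lam i *\<^sub>R (A i *v x)) = x" for x
    using arg_cong[OF A(2), of "\<lambda>B. B *v x"]
    by (simp add: sum_matrix_vector_mult scaleR_matrix_vector_mult)
  show "\<exists>idx. (\<forall>r\<in>{1..N}. idx r \<in> {1..m}) \<and>
      op_norm ((1 / real N) *\<^sub>R (\<Sum>r=1..N. A (idx r)) - mat 1) \<le> \<epsilon>"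
    \<comment> \<open>The matrix expression is turned into the operator average, acting on a real
      space of dimension \<open>2 * CARD('d)\<close>.\<close>
    unfolding op_norm_def matrix_vector_mult_diff_rdistrib scaleR_matrix_vector_mult
      sum_matrix_vector_mult matrix_vector_mul_lid
    by (rule exists_average_near_id[OF assms(2,3) _ _ _ mean assms(4,5,6,7)])
      (use A in \<open>auto simp: op_norm_def psd_complex_def inner_psd_complex_nonneg intro: adj_hermitian\<close>)
next
  fix A :: "nat \<Rightarrow> real^'d^'d"
  assume A: "\<forall>i\<in>{1..m}. psd_real (A i)" "(\<Sum>i=1..m. lam i *\<^sub>R A i) = mat 1"
    "\<forall>i\<in>{1..m}. op_norm (A i) \<le> M"
  have mean: "(\<Sum>i=1..m. lam i *\<^sub>R (A i *v x)) = x" for x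
    using arg_cong[OF A(2), of "\<lambda>B. B *v x"]
    by (simp add: sum_matrix_vector_mult scaleR_matrix_vector_mult)
  show "\<exists>idx. (\<forall>r\<in>{1..N}. idx r \<in> {1..m}) \<and>
      op_norm ((1 / real N) *\<^sub>R (\<Sum>r=1..N. A (idx r)) - mat 1) \<le> \<epsilon>"
    unfolding op_norm_def matrix_vector_mult_diff_rdistrib scaleR_matrix_vector_mult
      sum_matrix_vector_mult matrix_vector_mul_lid
    by (rule exists_average_near_id[OF assms(2,3) _ _ _ mean assms(4,5,6,7)])
      (use A in \<open>auto simp: op_norm_def psd_real_def inner_commute adj_psd_real\<close>)
qed

end
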